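(* Let $S$ be a near $e$ subsemigroup of a semitopological semigroup $(T,+)$ and let $A\subseteq S$. (1) If there is a sequence $\langle x_n\rangle_{n=1}^\infty$ in $S$ such that $\sum_{n=1}^\infty x_n$ converges near $e$ and $FS(\langle x_n\rangle_{n=1}^\infty)\subseteq A$, then there is an idempotent $p\in e_S^*$ with $A\in p$. (2) If $e$ has a countable local base in $T$ and there is an idempotent $p\in e_S^*$ with $A\in p$, then there is a sequence $\langle x_n\rangle_{n=1}^\infty$ in $S$ such that $\sum_{n=1}^\infty x_n$ converges near $e$ and $FS(\langle x_n\rangle_{n=1}^\infty)\subseteq A$.
   Context: A semitopological semigroup $(T,+)$ is a semigroup (additive notation, not necessarily commutative) with a Hausdorff topology in which all left and right translations are continuous; $E(T)$ its idempotents; $\tau_x$ the neighborhoods of $x$. A subsemigroup $S$ of $T$ with $e\in E(T)\setminus S$ is a near $e$ subsemigroup if $e\in cl_T(S)$. $\beta S$ is the set of ultrafilters on $S$ with $p+q=\{X:\{s:-s+X\in q\}\in p\}$, $-s+X=\{t\in S:s+t\in X\}$, and $e_S^*=\{p\in\beta S:U\cap S\in p\ \forall U\in\tau_e\}$. For $F=\{n_1<\dots<n_k\}$, $\sum_{n\in F}x_n=x_{n_1}+\dots+x_{n_k}$; $FS(\langle x_n\rangle_{n=m}^\infty)=\{\sum_{n\in F}x_n:F$ finite nonempty, $\min F\ge m\}$. $\sum_{n=1}^\infty x_n$ converges near $e$ if for each $U\in\tau_e$ there is $m\in\mathbb{N}$ with $FS(\langle x_n\rangle_{n=m}^\infty)\subseteq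 U$. *)

theory Defs
  imports "HOL-Analysis.Analysis"
begin

text \<open>
  Continuity of the translations is stated via preimages of open sets.  Addition is neither
  assumed jointly continuous nor commutative.
\<close>

class semitopological_semigroup_add = semigroup_add + t2_space +
  assumes continuous_left_translation: "\<And>a V. open V \<Longrightarrow> open ((\<lambda>x. a + x) -` V)"
    and continuous_right_translation: "\<And>a V. open V \<Longrightarrow> open ((\<lambda>x. x + a) -` V)"

lemma continuous_on_translations:
  fixes a :: "'a::semitopological_semigroup_add"
  shows "continuous_on UNIV (\<lambda>x. a + x)" and "continuous_on UNIV (\<lambda>x. x + a)"
  by (simp_all add: continuous_on_open_vimage continuous_left_translation
      continuous_right_translation)

definition idempotents :: "'a::semigroup_add set" where
  "idempotents = {e. e + e = e}"

text \<open>Neighbourhoods are not assumed to be open.\<close>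

definition nbhds_of :: "'a::topological_space \<Rightarrow> 'a set set" where
  "nbhds_of x = {U. x \<in> interior U}"

definition has_countable_local_base :: "'a::topological_space \<Rightarrow> bool" where
  "has_countable_local_base x \<longleftrightarrow>
     (\<exists>\<B>. countable \<B> \<and> \<B> \<subseteq> nbhds_of x \<and> (\<forall>U\<in>nbhds_of x. \<exists>V\<in>\<B>. V \<subseteq> U))"

definition subsemigroup :: "'a::semigroup_add set \<Rightarrow> bool" where
  "subsemigroup S \<longleftrightarrow> S \<noteq> {} \<and> (\<forall>s\<in>S. \<forall>t\<in>S. s + t \<in> S)"

definition near_subsemigroup :: "'a::semitopological_semigroup_add \<Rightarrow> 'a set \<Rightarrow> bool" where
  "near_subsemigroup e S \<longleftrightarrow> subsemigroup S \<and> e \<in> idempotents - S \<and> e \<in> closure S"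

text \<open>
  Ultrafilters on a set \<open>S\<close> are families of subsets of \<open>S\<close>; \<open>ultrafilters_on S\<close> is the
  underlying set of \<open>\<beta>S\<close>.
\<close>

definition ultrafilter_on :: "'a set \<Rightarrow> 'a set set \<Rightarrow> bool" where
  "ultrafilter_on S p \<longleftrightarrow>
     p \<subseteq> Pow S \<and> S \<in> p \<and> {} \<notin> p \<and>
     (\<forall>X\<in>p. \<forall>Y\<in>p. X \<inter> Y \<in> p) \<and>
     (\<forall>X\<in>p. \<forall>Y. X \<subseteq> Y \<and> Y \<subseteq> S \<longrightarrow> Y \<in> p) \<and>
     (\<forall>X. X \<subseteq> S \<longrightarrow> X \<in> p \<or> S - X \<in> p)"

definition ultrafilters_on :: "'a set \<Rightarrow> 'a set set set" where
  "ultrafilters_on S = {p. ultrafilter_on S p}"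

text \<open>The set \<open>-s + X\<close>, relative to \<open>S\<close>; \<open>s\<close> need not be invertible.\<close>

definition shift :: "'a::semigroup_add set \<Rightarrow> 'a \<Rightarrow> 'a set \<Rightarrow> 'a set" where
  "shift S s X = {t \<in> S. s + t \<in> X}"

definition uf_add :: "'a::semigroup_add set \<Rightarrow> 'a set set \<Rightarrow> 'a set set \<Rightarrow> 'a set set" where
  "uf_add S p q = {X. X \<subseteq> S \<and> {s \<in> S. shift S s X \<in> q} \<in> p}"

text \<open>The set \<open>e\<^sub>S\<^sup>*\<close> of ultrafilters on \<open>S\<close> converging to \<open>e\<close>.\<close>

definition near_ultrafilters :: "'a::topological_space \<Rightarrow> 'a set \<Rightarrow> 'a set set set" where
  "near_ultrafilters e S = {p \<in> ultrafilters_on S. \<forall>U\<in>nbhds_of e. U \<inter> S \<in> p}"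

text \<open>
  The sum \<open>x (n\<^sub>1) + \<dots> + x (n\<^sub>k)\<close> over \<open>F = {n\<^sub>1 < \<dots> < n\<^sub>k}\<close>, in increasing order of indices.  There is
  no neutral element, so the fold starts at the first summand; the value is only meaningful for
  finite nonempty \<open>F\<close>.
\<close>

definition ordered_sum :: "(nat \<Rightarrow> 'a::semigroup_add) \<Rightarrow> nat set \<Rightarrow> 'a" where
  "ordered_sum x F =
     (let xs = map x (sorted_list_of_set F) in foldl (+) (hd xs) (tl xs))"

definition FS :: "(nat \<Rightarrow> 'a::semigroup_add) \<Rightarrow> nat \<Rightarrow> 'a set" where
  "FS x m = {ordered_sum x F |F. finite F \<and> F \<noteq> {} \<and> m \<le> Min F}"

text \<open>Sequences are indexed from 1, so the value at 0 is never used.\<close>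

definition series_converges_near ::
    "'a::{semigroup_add,topological_space} \<Rightarrow> (nat \<Rightarrow> 'a) \<Rightarrow> bool" where
  "series_converges_near e x \<longleftrightarrow> (\<forall>U\<in>nbhds_of e. \<exists>m\<ge>1. FS x m \<subseteq> U)"

end

theory Submission
  imports Defs
begin

text \<open>
  Part (1) avoids the topology of \<open>\<beta>S\<close>: a closed subset of \<open>\<beta>S\<close> is represented by the filter of
  sets common to its members, and a filter \<open>F\<close> with \<open>F \<subseteq> F + F\<close> represents a closed
  subsemigroup.  If \<open>F\<close> is maximal with this property and \<open>q\<close> is an ultrafilter above \<open>F\<close>, then
  \<open>F + q = F\<close>, so \<open>F\<close> can be joined with the sets \<open>{s. -s + X \<in> q}\<close>, \<open>X \<in> q\<close>; by maximality these
  already lie in \<open>F \<subseteq> q\<close>, which says that \<open>q\<close> is idempotent.  This applies to the filter generated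
  by the tails \<open>FS x m\<close>.

  For part (2), choose \<open>x\<^sub>n \<in> Z\<^sub>n\<close> with \<open>-x\<^sub>n + Z\<^sub>n \<in> p\<close>, where
  \<open>Z\<^sub>0 \<subseteq> A\<close> and \<open>Z\<^sub>n\<^sub>+\<^sub>1\<close> is the intersection of \<open>Z\<^sub>n\<close>, \<open>-x\<^sub>n + Z\<^sub>n\<close> and the next basic neighbourhood of \<open>e\<close>.
  Adding the terms of a finite sum from the right gives \<open>FS x n \<subseteq> Z\<^sub>n\<close>.
\<close>

section \<open>Filters on a set\<close>

definition proper_filter_on :: "'a set \<Rightarrow> 'a set set \<Rightarrow> bool" where
  "proper_filter_on S F \<longleftrightarrow>
     F \<subseteq> Pow S \<and> S \<in> F \<and> {} \<notin> F \<and>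
     (\<forall>X\<in>F. \<forall>Y\<in>F. X \<inter> Y \<in> F) \<and>
     (\<forall>X\<in>F. \<forall>Y. X \<subseteq> Y \<and> Y \<subseteq> S \<longrightarrow> Y \<in> F)"

lemma ultrafilter_on_iff:
  "ultrafilter_on S p \<longleftrightarrow> proper_filter_on S p \<and> (\<forall>X. X \<subseteq> S \<longrightarrow> X \<in> p \<or> S - X \<in> p)"
  by (auto simp: ultrafilter_on_def proper_filter_on_def)

lemma proper_filter_onD:
  assumes "proper_filter_on S F"
  shows proper_filter_on_subset: "X \<in> F \<Longrightarrow> X \<subseteq> S"
    and proper_filter_on_space: "S \<in> F"
    and proper_filter_on_empty: "{} \<notin> F"
    and proper_filter_on_Int: "X \<in> F \<Longrightarrow> Y \<in> F \<Longrightarrow> X \<inter> Y \<in> F"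
    and proper_filter_on_mono: "X \<in> F \<Longrightarrow> X \<subseteq> Y \<Longrightarrow> Y \<subseteq> S \<Longrightarrow> Y \<in> F"
  using assms unfolding proper_filter_on_def by blast+

text \<open>In a chain, any two members of the union already lie in one common filter. This supplies
  the upper bounds for both applications of Zorn's lemma below.\<close>

lemma proper_filter_on_Union_chain:
  assumes "\<And>F. F \<in> C \<Longrightarrow> proper_filter_on S F" "C \<noteq> {}"
    and chain: "\<And>F G. F \<in> C \<Longrightarrow> G \<in> C \<Longrightarrow> F \<subseteq> G \<or> G \<subseteq> F"
  shows "proper_filter_on S (\<Union>C)"
  unfolding proper_filter_on_def
proof (intro conjI ballI allI impI)
  fix X Y assume "X \<in> \<Union>C" "Y \<in> \<Union>C"
  then obtain F G where FG: "F \<in> C" "G \<in> C" "X \<in> F" "Y \<in> G" by auto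
  with chain[of F G] obtain H where H: "H \<in> C" "X \<in> H" "Y \<in> H" by auto
  then show "X \<inter> Y \<in> \<Union>C" using proper_filter_on_Int[OF assms(1)[OF H(1)] H(2,3)] by auto
next
  fix X Y assume "X \<in> \<Union>C" "X \<subseteq> Y \<and> Y \<subseteq> S"
  then show "Y \<in> \<Union>C" using proper_filter_on_mono[OF assms(1)] by auto
next
  show "\<Union>C \<subseteq> Pow S" using proper_filter_on_subset[OF assms(1)] by auto
  show "S \<in> \<Union>C" using proper_filter_on_space[OF assms(1)] \<open>C \<noteq> {}\<close> by auto
  show "{} \<notin> \<Union>C" using proper_filter_on_empty[OF assms(1)] by auto
qed

text \<open>This is the filter generated by \<open>F\<close> and \<open>B\<close> when
  \<open>B\<close> is closed under binary intersections, which is why one member of \<open>B\<close>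
  suffices for each \<open>Z\<close>. In \<beta>S it corresponds to intersecting closed
  sets.\<close>

definition filter_join :: "'a set \<Rightarrow> 'a set set \<Rightarrow> 'a set set \<Rightarrow> 'a set set" where
  "filter_join S F B = {Z. Z \<subseteq> S \<and> (\<exists>Y\<in>F. \<exists>X\<in>B. Y \<inter> X \<subseteq> Z)}"

lemma proper_filter_on_join:
  assumes F: "proper_filter_on S F" and "B \<noteq> {}"
    and B: "\<And>X Y. X \<in> B \<Longrightarrow> Y \<in> B \<Longrightarrow> X \<inter> Y \<in> B"
    and meet: "\<And>X Y. Y \<in> F \<Longrightarrow> X \<in> B \<Longrightarrow> Y \<inter> X \<noteq> {}"
  shows "proper_filter_on S (filter_join S F B)"
  unfolding proper_filter_on_def
proof (intro conjI ballI allI impI)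
  fix Z W assume "Z \<in> filter_join S F B" "W \<in> filter_join S F B"
  then obtain Y X Y' X' where Z: "Z \<subseteq> S" "Y \<in> F" "X \<in> B" "Y \<inter> X \<subseteq> Z"
    and W: "Y' \<in> F" "X' \<in> B" "Y' \<inter> X' \<subseteq> W"
    unfolding filter_join_def by auto
  have "Y \<inter> Y' \<in> F" "X \<inter> X' \<in> B" using Z W proper_filter_on_Int[OF F] B by auto
  moreover have "(Y \<inter> Y') \<inter> (X \<inter> X') \<subseteq> Z \<inter> W" using Z W by auto
  ultimately show "Z \<inter> W \<in> filter_join S F B"
    unfolding filter_join_def using Z(1) by auto
next
  obtain X where "X \<in> B" using \<open>B \<noteq> {}\<close> by auto
  then show "S \<in> filter_join S F B"
    unfolding filter_join_def using proper_filter_on_space[OF F] by auto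
next
  show "{} \<notin> filter_join S F B"
    unfolding filter_join_def using meet by auto
next
  fix W Z assume "W \<in> filter_join S F B" and Z: "W \<subseteq> Z \<and> Z \<subseteq> S"
  then obtain Y X where "Y \<in> F" "X \<in> B" "Y \<inter> X \<subseteq> W" unfolding filter_join_def by auto
  moreover from this have "Y \<inter> X \<subseteq> Z" using Z by auto
  ultimately show "Z \<in> filter_join S F B" using Z by (auto simp: filter_join_def)
qed (auto simp: filter_join_def)

lemma filter_join_upper:
  assumes F: "proper_filter_on S F"
  shows "B \<noteq> {} \<Longrightarrow> F \<subseteq> filter_join S F B"
    and "B \<subseteq> Pow S \<Longrightarrow> B \<subseteq> filter_join S F B"
proof -
  show "F \<subseteq> filter_join S F B" if "B \<noteq> {}"
    using that proper_filter_on_subset[OF F] by (fastforce simp: filter_join_def)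
  show "B \<subseteq> filter_join S F B" if "B \<subseteq> Pow S"
    using that proper_filter_on_space[OF F] by (fastforce simp: filter_join_def)
qed

text \<open>Zorn's lemma gives a maximal filter \<open>M\<close> above \<open>F\<close>. If
  \<open>S - X\<close> is not in \<open>M\<close>, then \<open>X\<close> meets every member of
  \<open>M\<close>, so joining \<open>{X}\<close> to \<open>M\<close> keeps it proper, and
  maximality forces \<open>X \<in> M\<close>.\<close>

lemma ultrafilter_on_exists:
  assumes F: "proper_filter_on S F"
  obtains q where "ultrafilter_on S q" "F \<subseteq> q"
proof -
  let ?A = "{G. proper_filter_on S G \<and> F \<subseteq> G}"
  have "\<exists>M\<in>?A. \<forall>G\<in>?A. M \<subseteq> G \<longrightarrow> G = M"
  proof (rule subset_Zorn_nonempty)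
    show "?A \<noteq> {}" using F by blast
    fix C assume C: "C \<noteq> {}" "subset.chain ?A C"
    then have "proper_filter_on S (\<Union>C)"
      by (intro proper_filter_on_Union_chain) (auto simp: subset_chain_def)
    then show "\<Union>C \<in> ?A" using C by (fastforce simp: subset_chain_def)
  qed
  then obtain M where "M \<in> ?A" and maxA: "\<forall>G\<in>?A. M \<subseteq> G \<longrightarrow> G = M" by (rule bexE)
  then have M: "proper_filter_on S M" "F \<subseteq> M" by auto
  have max: "G = M" if "proper_filter_on S G" "M \<subseteq> G" for G
    using maxA that M by auto
  have "X \<in> M \<or> S - X \<in> M" if X: "X \<subseteq> S" for X
  proof (rule disjCI)
    assume nX: "S - X \<notin> M"
    have "Y \<inter> X \<noteq> {}" if "Y \<in> M" for Y
    proof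
      assume "Y \<inter> X = {}"
      then have "Y \<subseteq> S - X" using proper_filter_on_subset[OF M(1) that] by auto
      then show False using proper_filter_on_mono[OF M(1) that] nX by auto
    qed
    then have "proper_filter_on S (filter_join S M {X})"
      by (intro proper_filter_on_join M) auto
    then have "filter_join S M {X} = M" by (rule max) (intro filter_join_upper M, simp)
    then show "X \<in> M" using filter_join_upper(2)[OF M(1), of "{X}"] X by auto
  qed
  with M(1) have "ultrafilter_on S M" by (simp add: ultrafilter_on_iff)
  then show thesis using that M(2) by blast
qed

section \<open>Idempotent ultrafilters\<close>

definition translators :: "'a::semigroup_add set \<Rightarrow> 'a set set \<Rightarrow> 'a set \<Rightarrow> 'a set" where
  "translators S q X = {s \<in> S. shift S s X \<in> q}"

lemma uf_add_iff: "X \<in> uf_add S p q \<longleftrightarrow> X \<subseteq> S \<and> translators S q X \<in> p"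
  by (simp add: uf_add_def translators_def)

lemma shift_subset: "shift S s X \<subseteq> S"
  by (auto simp: shift_def)

lemma shift_mono: "X \<subseteq> Y \<Longrightarrow> shift S s X \<subseteq> shift S s Y"
  by (auto simp: shift_def)

lemma shift_Int: "shift S s (X \<inter> Y) = shift S s X \<inter> shift S s Y"
  by (auto simp: shift_def)

lemma translators_subset: "translators S q X \<subseteq> S"
  by (auto simp: translators_def)

lemma translators_mono:
  assumes "proper_filter_on S q" "X \<subseteq> Y"
  shows "translators S q X \<subseteq> translators S q Y"
  using proper_filter_on_mono[OF assms(1) _ shift_mono[OF assms(2)] shift_subset]
  by (auto simp: translators_def)

lemma translators_mono_filter: "p \<subseteq> q \<Longrightarrow> translators S p X \<subseteq> translators S q X"
  by (auto simp: translators_def)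

text \<open>Closure of \<open>q\<close> under intersections gives the nontrivial inclusion.
  Consequently the sets \<open>translators S q X\<close> with \<open>X \<in> q\<close> form a family
  that can be joined to a filter.\<close>

lemma translators_Int:
  assumes q: "proper_filter_on S q"
  shows "translators S q (X \<inter> Y) = translators S q X \<inter> translators S q Y"
  using translators_mono[OF q, of "X \<inter> Y"] proper_filter_on_Int[OF q]
  by (auto simp: translators_def shift_Int)

text \<open>Associativity of \<open>+\<close> gives \<open>-t + (-s + X) = -(s + t) + X\<close>.
  This is the source of associativity for \<open>uf_add\<close>.\<close>

lemma shift_translators:
  assumes "subsemigroup S" "s \<in> S"
  shows "shift S s (translators S q X) = translators S q (shift S s X)"
proof -
  have "shift S t (shift S s X) = shift S (s + t) X" if "t \<in> S" for t
    using assms that by (auto simp: shift_def subsemigroup_def add.assoc)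
  then show ?thesis using assms by (auto simp: shift_def[of S s] translators_def subsemigroup_def)
qed

lemma shift_space: "subsemigroup S \<Longrightarrow> s \<in> S \<Longrightarrow> shift S s S = S"
  by (auto simp: shift_def subsemigroup_def)

lemma translators_space:
  assumes "subsemigroup S" "proper_filter_on S q"
  shows "translators S q S = S"
  using assms proper_filter_on_space by (auto simp: translators_def shift_space)

lemma translators_empty:
  assumes "proper_filter_on S q"
  shows "translators S q {} = {}"
  using assms by (auto simp: translators_def shift_def dest: proper_filter_on_empty)

text \<open>If \<open>shift S s X\<close> is not in the ultrafilter \<open>q\<close>, its complement
  in \<open>S\<close> is; since \<open>s + t\<close> stays in \<open>S\<close>, that complement is
  \<open>shift S s (S - X)\<close>.\<close>

lemma translators_Diff:
  assumes S: "subsemigroup S" and q: "ultrafilter_on S q"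
  shows "S - translators S q X \<subseteq> translators S q (S - X)"
proof
  fix s assume s: "s \<in> S - translators S q X"
  then have "S - shift S s X \<in> q"
    using q shift_subset[of S s X] by (auto simp: ultrafilter_on_iff translators_def)
  moreover have "S - shift S s X = shift S s (S - X)"
    using S s by (auto simp: shift_def subsemigroup_def)
  ultimately show "s \<in> translators S q (S - X)" using s by (simp add: translators_def)
qed

lemma proper_filter_on_uf_add:
  assumes S: "subsemigroup S" and F: "proper_filter_on S F" and q: "proper_filter_on S q"
  shows "proper_filter_on S (uf_add S F q)"
  unfolding proper_filter_on_def
proof (intro conjI ballI allI impI)
  fix X Y assume "X \<in> uf_add S F q" "Y \<in> uf_add S F q"
  then show "X \<inter> Y \<in> uf_add S F q"
    using proper_filter_on_Int[OF F] by (auto simp: uf_add_iff translators_Int[OF q])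
next
  fix X Y assume "X \<in> uf_add S F q" "X \<subseteq> Y \<and> Y \<subseteq> S"
  then show "Y \<in> uf_add S F q"
    using proper_filter_on_mono[OF F _ translators_mono[OF q] translators_subset]
    by (auto simp: uf_add_iff)
qed (use proper_filter_onD(2,3)[OF F] in
    \<open>auto simp: uf_add_iff translators_space[OF S q] translators_empty[OF q]\<close>)

text \<open>A set of \<open>q\<close> outside \<open>p\<close> would have its complement in
  \<open>p \<subseteq> q\<close>, putting \<open>{}\<close> into \<open>q\<close>. This later
  upgrades \<open>q \<subseteq> q + q\<close> to an equality.\<close>

lemma ultrafilter_on_subset_eq:
  assumes p: "ultrafilter_on S p" and q: "proper_filter_on S q" and "p \<subseteq> q"
  shows "q = p"
proof
  show "q \<subseteq> p"
  proof
    fix X assume X: "X \<in> q"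
    then have "S - X \<notin> p"
      using proper_filter_on_Int[OF q X, of "S - X"] proper_filter_on_empty[OF q] \<open>p \<subseteq> q\<close> by auto
    then show "X \<in> p" using p proper_filter_on_subset[OF q X] by (auto simp: ultrafilter_on_iff)
  qed
qed fact

text \<open>A filter version of the Ellis-Numakura argument: larger filters stand for smaller closed
  sets, so a maximal \<open>F\<close> plays the role of a minimal closed subsemigroup.\<close>

lemma idempotent_ultrafilter_exists:
  assumes S: "subsemigroup S" and F0: "proper_filter_on S F0" "F0 \<subseteq> uf_add S F0 F0"
  obtains q where "ultrafilter_on S q" "F0 \<subseteq> q" "uf_add S q q = q"
proof -
  let ?A = "{G. proper_filter_on S G \<and> F0 \<subseteq> G \<and> G \<subseteq> uf_add S G G}"
  have "\<exists>M\<in>?A. \<forall>G\<in>?A. M \<subseteq> G \<longrightarrow> G = M"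
  proof (rule subset_Zorn_nonempty)
    show "?A \<noteq> {}" using F0 by blast
    fix C assume C: "C \<noteq> {}" "subset.chain ?A C"
    then have UC: "proper_filter_on S (\<Union>C)"
      by (intro proper_filter_on_Union_chain) (auto simp: subset_chain_def)
    \<comment> \<open>The set of translators grows with the filter, so a witness found in one
      \<open>G\<close> of the chain persists in the union.\<close>
    have "X \<in> uf_add S (\<Union>C) (\<Union>C)" if "X \<in> G" "G \<in> C" for X G
    proof -
      have "X \<subseteq> S" "translators S G X \<in> G"
        using C that by (auto simp: subset_chain_def uf_add_iff subset_iff)
      moreover have "translators S G X \<subseteq> translators S (\<Union>C) X"
        using that(2) by (intro translators_mono_filter) auto
      moreover from calculation(2) have "translators S G X \<in> \<Union>C" using that(2) by auto
      ultimately show ?thesis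
        unfolding uf_add_iff using proper_filter_on_mono[OF UC _ _ translators_subset] by metis
    qed
    then have "\<Union>C \<subseteq> uf_add S (\<Union>C) (\<Union>C)" by auto
    then show "\<Union>C \<in> ?A" using C UC by (fastforce simp: subset_chain_def)
  qed
  then obtain F where "F \<in> ?A" and maxA: "\<forall>G\<in>?A. F \<subseteq> G \<longrightarrow> G = F" by (rule bexE)
  then have F: "proper_filter_on S F" and "F0 \<subseteq> F" and FF: "F \<subseteq> uf_add S F F" by auto
  have max: "G = F" if "proper_filter_on S G" "F \<subseteq> G" "G \<subseteq> uf_add S G G" for G
    using maxA that \<open>F0 \<subseteq> F\<close> by auto
  have trF: "translators S F X \<in> F" if "X \<in> F" for X
    using FF that by (auto simp: uf_add_iff)
  obtain q where q: "ultrafilter_on S q" and "F \<subseteq> q"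
    using ultrafilter_on_exists[OF F] .
  then have qf: "proper_filter_on S q" by (simp add: ultrafilter_on_iff)
  let ?tr = "translators S q"
  have sub: "F \<subseteq> uf_add S F q"
    using trF proper_filter_on_subset[OF F]
      proper_filter_on_mono[OF F _ translators_mono_filter[OF \<open>F \<subseteq> q\<close>] translators_subset]
    by (auto simp: uf_add_iff)
  have Fq: "uf_add S F q = F"
  proof (rule max[OF proper_filter_on_uf_add[OF S F qf] sub], rule subsetI)
    fix X assume X: "X \<in> uf_add S F q"
    \<comment> \<open>Here \<open>X \<in> F + q\<close> means \<open>?tr X \<in> F\<close>, and
      \<open>F\<close> is closed under \<open>translators S F\<close>. The next equation is
      associativity: it identifies this set with the translators of \<open>X\<close> for
      \<open>F + q\<close>.\<close>
    then have "translators S F (?tr X) \<in> uf_add S F q"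
      by (intro subsetD[OF sub] trF) (simp add: uf_add_iff)
    moreover have "translators S F (?tr X) = translators S (uf_add S F q) X"
      using S by (auto simp: translators_def[of S F] translators_def[of S "uf_add S F q"]
          shift_translators uf_add_iff shift_subset)
    ultimately show "X \<in> uf_add S (uf_add S F q) (uf_add S F q)"
      using X by (auto simp: uf_add_iff[of X])
  qed
  \<comment> \<open>The ultrafilters above \<open>?G\<close> are those \<open>r\<close> above
    \<open>F\<close> with \<open>r + q = q\<close>, the closed set used in the classical
    proof.\<close>
  let ?G = "filter_join S F (?tr ` q)"
  have ne: "?tr ` q \<noteq> {}" using proper_filter_on_space[OF qf] by blast
  have G: "proper_filter_on S ?G"
  proof (rule proper_filter_on_join[OF F ne])
    fix U V assume "U \<in> ?tr ` q" "V \<in> ?tr ` q"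
    then obtain X Y where "X \<in> q" "Y \<in> q" "U = ?tr X" "V = ?tr Y" by blast
    then show "U \<inter> V \<in> ?tr ` q"
      using proper_filter_on_Int[OF qf] by (simp flip: translators_Int[OF qf])
  next
    fix Y U assume Y: "Y \<in> F" and "U \<in> ?tr ` q"
    then obtain X where X: "X \<in> q" "U = ?tr X" by blast
    show "Y \<inter> U \<noteq> {}"
    proof
      assume "Y \<inter> U = {}"
      \<comment> \<open>This is where \<open>F + q = F\<close> makes the join proper: it would put
        \<open>S - X\<close> into \<open>F\<close>, hence into \<open>q\<close> beside
        \<open>X\<close>.\<close>
      then have "Y \<subseteq> ?tr (S - X)"
        using translators_Diff[OF S q, of X] proper_filter_on_subset[OF F Y] X by blast
      then have "S - X \<in> uf_add S F q"
        using proper_filter_on_mono[OF F Y _ translators_subset] by (auto simp: uf_add_iff)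
      then have "S - X \<in> q" using Fq \<open>F \<subseteq> q\<close> by blast
      then show False
        using proper_filter_on_Int[OF qf X(1), of "S - X"] proper_filter_on_empty[OF qf] by auto
    qed
  qed
  have FG: "F \<subseteq> ?G" using ne by (rule filter_join_upper[OF F])
  have trG: "?tr ` q \<subseteq> ?G" using translators_subset by (intro filter_join_upper[OF F]) auto
  have "?G \<subseteq> uf_add S ?G ?G"
  proof
    fix Z assume "Z \<in> ?G"
    then obtain Y X where Z: "Z \<subseteq> S" "Y \<inter> ?tr X \<subseteq> Z" "Y \<in> F" "X \<in> q"
      unfolding filter_join_def by blast
    \<comment> \<open>Shifting a generator \<open>Y \<inter> ?tr X\<close> by such an
      \<open>s\<close> yields a generator again, with \<open>shift S s Y \<in> F\<close> and
      \<open>shift S s X \<in> q\<close>.\<close>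
    have "translators S F Y \<inter> ?tr X \<subseteq> translators S ?G Z"
    proof
      fix s assume "s \<in> translators S F Y \<inter> ?tr X"
      then have s: "s \<in> S" "shift S s Y \<in> F" "shift S s X \<in> q"
        by (auto simp: translators_def)
      then have "shift S s Y \<inter> ?tr (shift S s X) \<in> ?G"
        using FG trG by (intro proper_filter_on_Int[OF G]) auto
      then have "shift S s (Y \<inter> ?tr X) \<in> ?G"
        using s S by (simp add: shift_Int shift_translators)
      then have "shift S s Z \<in> ?G"
        using proper_filter_on_mono[OF G _ shift_mono[OF Z(2)] shift_subset] by blast
      then show "s \<in> translators S ?G Z" using s by (simp add: translators_def)
    qed
    moreover have "translators S F Y \<inter> ?tr X \<in> ?G"
      using FG trG trF Z by (intro proper_filter_on_Int[OF G]) auto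
    ultimately show "Z \<in> uf_add S ?G ?G"
      using Z(1) proper_filter_on_mono[OF G _ _ translators_subset] by (auto simp: uf_add_iff)
  qed
  then have "?G = F" by (rule max[OF G FG])
  then have "?tr X \<in> q" if "X \<in> q" for X using that trG \<open>F \<subseteq> q\<close> by auto
  then have "q \<subseteq> uf_add S q q"
    using proper_filter_on_subset[OF qf] by (auto simp: uf_add_iff)
  then have "uf_add S q q = q"
    by (rule ultrafilter_on_subset_eq[OF q proper_filter_on_uf_add[OF S qf qf]])
  moreover have "F0 \<subseteq> q" using \<open>F0 \<subseteq> F\<close> \<open>F \<subseteq> q\<close> by simp
  ultimately show thesis using that q by simp
qed

section \<open>Finite sums\<close>

lemma ordered_sum_singleton: "ordered_sum x {n} = x n"
  by (simp add: ordered_sum_def)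

lemma sorted_list_of_set_Un:
  fixes F G :: "'a::linorder set"
  assumes "finite F" "finite G" "\<And>i j. i \<in> F \<Longrightarrow> j \<in> G \<Longrightarrow> i < j"
  shows "sorted_list_of_set (F \<union> G) = sorted_list_of_set F @ sorted_list_of_set G"
proof (rule sorted_distinct_set_unique)
  show "sorted (sorted_list_of_set F @ sorted_list_of_set G)"
    using assms by (auto simp: sorted_append intro: less_imp_le)
  show "distinct (sorted_list_of_set F @ sorted_list_of_set G)"
    using assms by auto
qed (use assms in auto)

text \<open>Associativity lets a left summand leave the fold, whose start value is the first summand
  instead of a neutral element.\<close>

lemma foldl_add_assoc: "foldl (+) (a + b) xs = a + foldl (+) (b::'a::semigroup_add) xs"
  by (induction xs arbitrary: b) (auto simp: add.assoc)

lemma ordered_sum_Un: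
  assumes "finite F" "F \<noteq> {}" "finite G" "G \<noteq> {}" "\<And>i j. i \<in> F \<Longrightarrow> j \<in> G \<Longrightarrow> i < j"
  shows "ordered_sum x (F \<union> G) = ordered_sum x F + ordered_sum x G"
proof -
  obtain i k where i: "sorted_list_of_set F = i # k"
    using assms by (cases "sorted_list_of_set F") auto
  obtain j l where j: "sorted_list_of_set G = j # l"
    using assms by (cases "sorted_list_of_set G") auto
  have "sorted_list_of_set (F \<union> G) = (i # k) @ (j # l)"
    using sorted_list_of_set_Un[OF assms(1,3,5)] i j by simp
  then show ?thesis by (simp add: ordered_sum_def i j foldl_add_assoc)
qed

lemma in_FS: "s \<in> FS x m \<longleftrightarrow> (\<exists>F. finite F \<and> F \<noteq> {} \<and> (\<forall>i\<in>F. m \<le> i) \<and> s = ordered_sum x F)"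
  unfolding FS_def mem_Collect_eq using Min_ge_iff by metis

lemma FS_antimono: "m \<le> n \<Longrightarrow> FS x n \<subseteq> FS x m"
proof
  fix s assume "m \<le> n" "s \<in> FS x n"
  then obtain F where F: "finite F" "F \<noteq> {}" "\<forall>i\<in>F. n \<le> i" "s = ordered_sum x F"
    unfolding in_FS by auto
  then show "s \<in> FS x m"
    unfolding in_FS using \<open>m \<le> n\<close> by (intro exI[of _ F]) auto
qed

lemma FS_nonempty: "FS x m \<noteq> {}"
proof -
  have "ordered_sum x {m} \<in> FS x m" unfolding in_FS by (intro exI[of _ "{m}"]) simp
  then show ?thesis by auto
qed

text \<open>Taking \<open>n\<close> beyond every index used in \<open>s\<close> makes the index set
  of \<open>t\<close> follow that of \<open>s\<close>, so no reordering occurs when the sums are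
  joined. This yields \<open>F \<subseteq> F + F\<close> for the filter of tails.\<close>

lemma FS_add_tail:
  assumes "s \<in> FS x m"
  obtains n where "m \<le> n" "\<And>t. t \<in> FS x n \<Longrightarrow> s + t \<in> FS x m"
proof -
  obtain F where F: "finite F" "F \<noteq> {}" "\<forall>i\<in>F. m \<le> i" "s = ordered_sum x F"
    using assms unfolding in_FS by blast
  let ?n = "Suc (Max F)"
  have "m \<le> Max F" using F by auto
  have "s + t \<in> FS x m" if t: "t \<in> FS x ?n" for t
  proof -
    obtain G where G: "finite G" "G \<noteq> {}" "\<forall>j\<in>G. ?n \<le> j" "t = ordered_sum x G"
      using t unfolding in_FS by blast
    have "i < j" if "i \<in> F" "j \<in> G" for i j
      using Max_ge[OF F(1) that(1)] G(3) that(2) by fastforce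
    then have "s + t = ordered_sum x (F \<union> G)"
      using F G by (simp add: ordered_sum_Un)
    moreover have "\<forall>i\<in>F \<union> G. m \<le> i" using F(3) G(3) \<open>m \<le> Max F\<close> by fastforce
    ultimately show ?thesis unfolding in_FS using F(1,2) G(1) by blast
  qed
  then show thesis using that[of ?n] \<open>m \<le> Max F\<close> by simp
qed

text \<open>Induction on the number of indices: split off the least index \<open>k\<close>, place
  the remaining sum in \<open>Z (Suc k)\<close>, apply \<open>step\<close>, and descend from
  \<open>Z k\<close> to \<open>Z m\<close>. The bound \<open>m\<close> is generalized because the
  remainder is treated at level \<open>Suc k\<close>.\<close>

lemma FS_subset_decreasing:
  assumes x: "\<And>n. x n \<in> Z n" and "antimono Z"
    and step: "\<And>n t. t \<in> Z (Suc n) \<Longrightarrow> x n + t \<in> Z n"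
  shows "FS x m \<subseteq> Z m"
proof
  fix s assume "s \<in> FS x m"
  then obtain F where "finite F" "F \<noteq> {}" "\<forall>i\<in>F. m \<le> i" "s = ordered_sum x F"
    unfolding in_FS by blast
  moreover have "finite F \<Longrightarrow> F \<noteq> {} \<Longrightarrow> (\<forall>i\<in>F. m \<le> i) \<Longrightarrow> ordered_sum x F \<in> Z m" for F m
  proof (induction "card F" arbitrary: F m rule: less_induct)
    case less
    define k where "k = Min F"
    define G where "G = F - {k}"
    have k: "k \<in> F" "m \<le> k" using less.prems unfolding k_def by auto
    have "ordered_sum x F \<in> Z k"
    proof (cases "G = {}")
      case True
      then have "F = {k}" using k unfolding G_def by blast
      then show ?thesis using x by (simp add: ordered_sum_singleton)
    next
      case False
      have gt: "k < i" if "i \<in> G" for i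
        using that Min_le[OF less.prems(1), of i] unfolding G_def k_def by auto
      then have "ordered_sum x ({k} \<union> G) = ordered_sum x {k} + ordered_sum x G"
        using False less.prems(1) by (intro ordered_sum_Un) (auto simp: G_def)
      moreover have "{k} \<union> G = F" using k unfolding G_def by blast
      moreover have "card G < card F"
        unfolding G_def using less.prems(1) k(1) by (rule card_Diff1_less)
      then have "ordered_sum x G \<in> Z (Suc k)"
        using False gt less.prems(1) by (intro less.hyps) (auto simp: G_def Suc_le_eq)
      ultimately show ?thesis using step by (simp add: ordered_sum_singleton)
    qed
    then show ?case using antimonoD[OF \<open>antimono Z\<close> k(2)] by blast
  qed
  ultimately show "s \<in> Z m" by blast
qed

section \<open>Sequences and idempotents near \<open>e\<close>\<close>

lemma idempotent_from_sequence:
  assumes S: "subsemigroup S" and "A \<subseteq> S"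
    and conv: "series_converges_near e x" and FSA: "FS x 1 \<subseteq> A"
  obtains p where "p \<in> near_ultrafilters e S" "uf_add S p p = p" "A \<in> p"
proof -
  \<comment> \<open>The bound \<open>m\<ge>1\<close> matters: \<open>x 0\<close> is arbitrary, so
    \<open>FS x 0\<close> may leave \<open>A\<close>.\<close>
  define F where "F = {X. X \<subseteq> S \<and> (\<exists>m\<ge>1. FS x m \<subseteq> X)}"
  have FS_S: "FS x m \<subseteq> A" if "m \<ge> 1" for m
    using FS_antimono[OF that] FSA by blast
  have F: "proper_filter_on S F"
    unfolding proper_filter_on_def
  proof (intro conjI ballI allI impI)
    fix X Y assume "X \<in> F" "Y \<in> F"
    then obtain m n where mn: "X \<subseteq> S" "m \<ge> 1" "FS x m \<subseteq> X" "FS x n \<subseteq> Y"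
      unfolding F_def by blast
    then have "FS x (max m n) \<subseteq> X" "FS x (max m n) \<subseteq> Y"
      using FS_antimono[of m "max m n" x] FS_antimono[of n "max m n" x] by simp_all
    then show "X \<inter> Y \<in> F"
      unfolding F_def using mn(1,2) by (auto intro!: exI[of _ "max m n"])
  next
    show "S \<in> F" using FSA \<open>A \<subseteq> S\<close> unfolding F_def by auto
    show "{} \<notin> F" using FS_nonempty unfolding F_def by blast
  next
    fix X Y assume "X \<in> F" "X \<subseteq> Y \<and> Y \<subseteq> S"
    then show "Y \<in> F" unfolding F_def using subset_trans by fast
  qed (auto simp: F_def)
  have "F \<subseteq> uf_add S F F"
  proof
    fix X assume "X \<in> F"
    then obtain m where m: "X \<subseteq> S" "m \<ge> 1" "FS x m \<subseteq> X" unfolding F_def by blast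
    have "FS x m \<subseteq> translators S F X"
    proof
      fix s assume s: "s \<in> FS x m"
      then obtain n where n: "m \<le> n" "\<And>t. t \<in> FS x n \<Longrightarrow> s + t \<in> FS x m"
        by (rule FS_add_tail) blast
      have "1 \<le> n" using m(2) n(1) by simp
      then have "FS x n \<subseteq> shift S s X"
        using n(2) m(3) FS_S \<open>A \<subseteq> S\<close> unfolding shift_def by blast
      then have "shift S s X \<in> F" using \<open>1 \<le> n\<close> shift_subset unfolding F_def by blast
      then show "s \<in> translators S F X"
        using s m(1,3) unfolding translators_def by blast
    qed
    then show "X \<in> uf_add S F F"
      using m(1,2) translators_subset[of S F X] unfolding uf_add_iff F_def by blast
  qed
  then obtain q where q: "ultrafilter_on S q" "F \<subseteq> q" "uf_add S q q = q"
    by (rule idempotent_ultrafilter_exists[OF S F])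
  \<comment> \<open>Convergence of the series places the trace of each neighbourhood in
    \<open>F\<close>, so every ultrafilter above \<open>F\<close> converges to
    \<open>e\<close>.\<close>
  have "U \<inter> S \<in> F" if "U \<in> nbhds_of e" for U
  proof -
    obtain m where "m \<ge> 1" "FS x m \<subseteq> U"
      using conv \<open>U \<in> nbhds_of e\<close> unfolding series_converges_near_def by auto
    moreover from this have "FS x m \<subseteq> S" using FS_S \<open>A \<subseteq> S\<close> by auto
    ultimately show ?thesis unfolding F_def by auto
  qed
  then have "q \<in> near_ultrafilters e S"
    using q by (auto simp: near_ultrafilters_def ultrafilters_on_def)
  moreover have "A \<in> F" using FSA \<open>A \<subseteq> S\<close> unfolding F_def by auto
  then have "A \<in> q" using q(2) by auto
  ultimately show thesis using that q(3) by simp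
qed

lemma sequence_from_idempotent:
  assumes base: "has_countable_local_base e"
    and p: "p \<in> near_ultrafilters e S" "uf_add S p p = p" "A \<in> p"
  obtains x where "\<And>n. x n \<in> S" "series_converges_near e x" "\<And>m. FS x m \<subseteq> A"
proof -
  have pf: "proper_filter_on S p"
    using p(1) by (auto simp: near_ultrafilters_def ultrafilters_on_def ultrafilter_on_iff)
  obtain \<B> where \<B>: "countable \<B>" "\<B> \<subseteq> nbhds_of e" "\<forall>U\<in>nbhds_of e. \<exists>V\<in>\<B>. V \<subseteq> U"
    using base unfolding has_countable_local_base_def by auto
  have "UNIV \<in> nbhds_of e" by (simp add: nbhds_of_def)
  then have "\<B> \<noteq> {}" using \<B>(3) by blast
  then obtain V :: "nat \<Rightarrow> _" where V: "\<B> = range V"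
    using range_from_nat_into[OF _ \<B>(1)] by metis
  have Vp: "V n \<inter> S \<in> p" for n
    using p(1) \<B>(2) V by (auto simp: near_ultrafilters_def)
  \<comment> \<open>Idempotence enters here: \<open>X \<in> p = p + p\<close> puts
    \<open>translators S p X\<close> into \<open>p\<close>, so it meets \<open>X\<close>.\<close>
  have "\<exists>s\<in>X. shift S s X \<in> p" if "X \<in> p" for X
  proof -
    have "X \<inter> translators S p X \<in> p"
      using that p(2) uf_add_iff[of X S p p] by (intro proper_filter_on_Int[OF pf]) simp_all
    then have "X \<inter> translators S p X \<noteq> {}" using proper_filter_on_empty[OF pf] by metis
    then show ?thesis by (auto simp: translators_def)
  qed
  then obtain f where f: "\<And>X. X \<in> p \<Longrightarrow> f X \<in> X \<and> shift S (f X) X \<in> p" by metis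
  \<comment> \<open>The basic neighbourhoods \<open>V n\<close> need not decrease; the intersections
    make \<open>Z\<close> decreasing, while \<open>f\<close> supplies the next term from the current
    set.\<close>
  define Z where "Z = rec_nat (A \<inter> (V 0 \<inter> S)) (\<lambda>n X. X \<inter> shift S (f X) X \<inter> (V (Suc n) \<inter> S))"
  define x where "x n = f (Z n)" for n
  have Z0: "Z 0 = A \<inter> (V 0 \<inter> S)"
    and ZS: "Z (Suc n) = Z n \<inter> shift S (x n) (Z n) \<inter> (V (Suc n) \<inter> S)" for n
    by (simp_all add: Z_def x_def)
  have Zp: "Z n \<in> p" for n
  proof (induction n)
    case 0
    then show ?case using Z0 p(3) Vp proper_filter_on_Int[OF pf] by simp
  next
    case (Suc n)
    then have "shift S (x n) (Z n) \<in> p" using f by (simp add: x_def)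
    then show ?case using ZS Suc Vp proper_filter_on_Int[OF pf] by simp
  qed
  have xZ: "x n \<in> Z n" for n using f Zp by (simp add: x_def)
  have "antimono Z" by (rule antimono_iff_le_Suc[THEN iffD2]) (auto simp: ZS)
  have ZV: "Z n \<subseteq> V n" for n by (cases n) (auto simp: Z0 ZS)
  have FSZ: "FS x n \<subseteq> Z n" for n
    by (rule FS_subset_decreasing[OF xZ \<open>antimono Z\<close>]) (auto simp: ZS shift_def)
  have "series_converges_near e x"
    unfolding series_converges_near_def
  proof
    fix U assume "U \<in> nbhds_of e"
    then obtain n where "V n \<subseteq> U" using \<B>(3) V by blast
    \<comment> \<open>The successor ensures a starting index of at least 1 even when
      \<open>n = 0\<close>, since the recursion starts at 0.\<close>
    then have "FS x (Suc n) \<subseteq> U"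
      using FS_antimono[of n "Suc n" x] FSZ[of n] ZV[of n] by auto
    then show "\<exists>m\<ge>1. FS x m \<subseteq> U" by (intro exI[of _ "Suc n"]) simp
  qed
  moreover have "Z n \<subseteq> A" for n using antimonoD[OF \<open>antimono Z\<close>, of 0 n] Z0 by auto
  moreover have "x n \<in> S" for n using xZ[of n] proper_filter_on_subset[OF pf Zp] by blast
  ultimately show thesis using subset_trans[OF FSZ] by (intro that[of x]) simp_all
qed

theorem theorem2p9:
  fixes e :: "'a::semitopological_semigroup_add" and S A :: "'a set"
  assumes "near_subsemigroup e S" and "A \<subseteq> S"
  shows "((\<exists>x :: nat \<Rightarrow> 'a. (\<forall>n\<ge>1. x n \<in> S) \<and> series_converges_near e x \<and> FS x 1 \<subseteq> A) \<longrightarrow>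
            (\<exists>p\<in>near_ultrafilters e S. uf_add S p p = p \<and> A \<in> p)) \<and>
         (has_countable_local_base e \<and>
            (\<exists>p\<in>near_ultrafilters e S. uf_add S p p = p \<and> A \<in> p) \<longrightarrow>
            (\<exists>x :: nat \<Rightarrow> 'a. (\<forall>n\<ge>1. x n \<in> S) \<and> series_converges_near e x \<and> FS x 1 \<subseteq> A))"
proof (intro conjI impI)
  have "subsemigroup S" using assms(1) by (simp add: near_subsemigroup_def)
  moreover assume "\<exists>x. (\<forall>n\<ge>1. x n \<in> S) \<and> series_converges_near e x \<and> FS x 1 \<subseteq> A"
  ultimately show "\<exists>p\<in>near_ultrafilters e S. uf_add S p p = p \<and> A \<in> p"
    using idempotent_from_sequence[OF _ assms(2)] by metis
next
  assume "has_countable_local_base e \<and> (\<exists>p\<in>near_ultrafilters e S. uf_add S p p = p \<and> A \<in> p)"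
  then show "\<exists>x. (\<forall>n\<ge>1. x n \<in> S) \<and> series_converges_near e x \<and> FS x 1 \<subseteq> A"
    using sequence_from_idempotent by metis
qed

end
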